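(* In the two-terminal distributed source-channel coding setting described in the context, the expectation, over the data distribution $p_{\mathbf{x}_1,\mathbf{x}_2}$, of the Kullback-Leibler divergence between the parametric variational density $q(\hat{\mathbf{s}}_1,\hat{\mathbf{s}}_2,\tilde{\mathbf{z}}_1,\tilde{\mathbf{z}}_2|\mathbf{x}_1,\mathbf{x}_2)$ and the true joint posterior $p(\hat{\mathbf{s}}_1,\hat{\mathbf{s}}_2,\tilde{\mathbf{z}}_1,\tilde{\mathbf{z}}_2|\mathbf{x}_1,\mathbf{x}_2)$ is given by $$\mathbb{E}_{p_{\mathbf{x}_1,\mathbf{x}_2}}D_{KL}\big[q(\hat{\mathbf{s}}_1,\hat{\mathbf{s}}_2,\tilde{\mathbf{z}}_1,\tilde{\mathbf{z}}_2|\mathbf{x}_1,\mathbf{x}_2)\,\big\|\,p(\hat{\mathbf{s}}_1,\hat{\mathbf{s}}_2,\tilde{\mathbf{z}}_1,\tilde{\mathbf{z}}_2|\mathbf{x}_1,\mathbf{x}_2)\big]$$ $$=\mathbb{E}_{p_{\mathbf{x}_1,\mathbf{x}_2}}\mathbb{E}_{q_{\hat{\mathbf{s}}_1,\hat{\mathbf{s}}_2,\tilde{\mathbf{z}}_1,\tilde{\mathbf{z}}_2|\mathbf{x}_1,\mathbf{x}_2}}\Big\{\underbrace{-\log p(\mathbf{x}_1,\mathbf{x}_2|\hat{\mathbf{s}}_1,\hat{\mathbf{s}}_2,\tilde{\mathbf{z}}_1,\tilde{\mathbf{z}}_2)}_{\text{weighted distortion}}-\underbrace{\log p(\hat{\mathbf{s}}_1|\tilde{\mathbf{z}}_1)-\log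 p(\hat{\mathbf{s}}_2|\tilde{\mathbf{z}}_2)-\log p(\tilde{\mathbf{z}}_1,\tilde{\mathbf{z}}_2)}_{\text{rate}}\Big\}+\mathrm{const},$$ where $\mathrm{const}$ denotes a constant.
   Context: Setting: two physically separated terminals $i\in\{1,2\}$ observe correlated images $\mathbf{x}_1,\mathbf{x}_2\in\mathbb{R}^{C\times H\times W}$ with joint data distribution $p_{\mathbf{x}_1,\mathbf{x}_2}$. Terminal $i$ maps $\mathbf{x}_i$ by a neural-network analysis transform to a latent representation $\mathbf{y}_i\in\mathbb{R}^{N_y}$, maps $\mathbf{y}_i$ by a second parametric analysis transform to a hyperprior $\mathbf{z}_i\in\mathbb{R}^{N_z}$ ($N_z\ll N_y$), and encodes $\mathbf{y}_i$ by a joint source-channel encoder into a channel input $\mathbf{s}_i\in\mathbb{C}^n$. The inputs are sent over dedicated independent channels, with outputs $\hat{\mathbf{s}}_i=\mathbf{s}_i+\mathbf{n}_i$, where $\mathbf{n}_i\sim\mathcal{CN}(\mathbf{0},\epsilon_i^2\mathbf{I}_{n\times n})$ is i.i.d. complex Gaussian noise and $\epsilon_1^2=\epsilon_2^2=\epsilon^2$. The variables $\tilde{\mathbf{y}}_i$ and $\tilde{\mathbf{z}}_i$ denote $\mathbf{y}_i$ and $\mathbf{z}_i$ with their densities convolved with a standard uniform density on $(-\tfrac12,\tfrac12)$ in each coordinate. Probability models: the elements of $\mathbf{y}_i$ are assumed independent given the hyperprior, with $p(\tilde{\mathbf{y}}_i|\tilde{\mathbf{z}}_i)=\prod_j\big(\mathcal{N}(\mu_i^j,\sigma_i^j)*\mathcal{U}(-\tfrac12,\tfrac12)\big)(\tilde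 y_i^j)$, where $*$ is convolution and the means $\mu_i^j$ and standard deviations $\sigma_i^j$ are parametric functions of $\tilde{\mathbf{z}}_i$. The joint entropy model is $p(\tilde{\mathbf{y}}_1,\tilde{\mathbf{y}}_2,\tilde{\mathbf{z}}_1,\tilde{\mathbf{z}}_2)=p(\tilde{\mathbf{z}}_1,\tilde{\mathbf{z}}_2)\,p(\tilde{\mathbf{y}}_1|\tilde{\mathbf{z}}_1)\,p(\tilde{\mathbf{y}}_2|\tilde{\mathbf{z}}_2)$, with $p(\tilde{\mathbf{z}}_1,\tilde{\mathbf{z}}_2)$ a learned joint density of the hyperpriors. The density $p(\hat{\mathbf{s}}_i|\tilde{\mathbf{z}}_i)$ is the convolution of $p(\mathbf{s}_i|\tilde{\mathbf{z}}_i)$ with the Gaussian noise. The symbols $p(\cdot)$ and $p(\cdot|\cdot)$ denote the (marginal, conditional) densities of the indicated variables; $p(\hat{\mathbf{s}}_1,\hat{\mathbf{s}}_2,\tilde{\mathbf{z}}_1,\tilde{\mathbf{z}}_2|\mathbf{x}_1,\mathbf{x}_2)$ is the true but intractable joint posterior. Variational density: $q$ is the parametric density, determined by the encoders, the channel noise and the uniform noise, that approximates this posterior: $$q(\hat{\mathbf{s}}_1,\hat{\mathbf{s}}_2,\tilde{\mathbf{z}}_1,\tilde{\mathbf{z}}_2|\mathbf{x}_1,\mathbf{x}_2)=\prod_k\mathcal{N}(\hat{s}_1^k|s_1^k,\epsilon_1^2)\prod_j\mathcal{N}(\hat{s}_2^j|s_2^j,\epsilon_2^2)\prod_m\mathcal{U}(\tilde{z}_1^m|z_1^m-\tfrac12,z_1^m+\tfrac12)\prod_l\mathcal{U}(\tilde{z}_2^l|z_2^l-\tfrac12,z_2^l+\tfrac12),$$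 where superscripts index coordinates, $\mathcal{N}(\cdot|s,\epsilon_i^2)$ is the (complex) Gaussian density with mean $s$ and variance $\epsilon_i^2$, and $\mathcal{U}(\cdot|a,b)$ is the uniform density on $(a,b)$. $D_{KL}[q\|p]=\mathbb{E}_q[\log q-\log p]$ is the Kullback-Leibler divergence, for densities in $(\hat{\mathbf{s}}_1,\hat{\mathbf{s}}_2,\tilde{\mathbf{z}}_1,\tilde{\mathbf{z}}_2)$ with $(\mathbf{x}_1,\mathbf{x}_2)$ fixed.
   Formalization: The data distribution of the two images is assumed to have a density with finite differential entropy; without this the constant, which contains the expectation of log p(x1,x2), is not a finite number and the identity can fail. *)

theory Defs
  imports "HOL-Probability.Probability"
begin

section \<open>Extended-real logarithms, expectations and Kullback-Leibler divergence\<close>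

definition elog :: "real \<Rightarrow> ereal" where
  "elog t = (if t \<le> 0 then -\<infinity> else ereal (ln t))"

text \<open>
  The Bochner integral is 0 for functions that are not integrable, so it cannot express a
  divergence or an expected negative log-likelihood that may be infinite. The following is the
  usual integral of an extended-real function, the integral of the positive part minus that of the
  negative part. (On \<^term>\<open>\<infinity> - \<infinity> :: ereal\<close>, where the expectation does not exist, its
  value carries no meaning.)
\<close>

definition ereal_expectation :: "'a measure \<Rightarrow> ('a \<Rightarrow> ereal) \<Rightarrow> ereal" where
  "ereal_expectation M f =
     enn2ereal (\<integral>\<^sup>+x. e2ennreal (f x) \<partial>M) - enn2ereal (\<integral>\<^sup>+x. e2ennreal (- f x) \<partial>M)"

definition KL_density :: "('a::euclidean_space \<Rightarrow> real) \<Rightarrow> ('a \<Rightarrow> real) \<Rightarrow> ereal" where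
  "KL_density q p = ereal_expectation (density lborel q) (\<lambda>w. elog (q w) - elog (p w))"

lemma ereal_expectation_integrable:
  assumes "integrable M f"
  shows "ereal_expectation M (\<lambda>x. ereal (f x)) = ereal (\<integral>x. f x \<partial>M)"
proof -
  have fin: "(\<integral>\<^sup>+x. ennreal (f x) \<partial>M) \<noteq> \<infinity>" "(\<integral>\<^sup>+x. ennreal (- f x) \<partial>M) \<noteq> \<infinity>"
    using assms by (auto simp: real_integrable_def)
  have "enn2ereal a - enn2ereal b = ereal (enn2real a - enn2real b)"
    if "a \<noteq> \<infinity>" "b \<noteq> \<infinity>" for a b :: ennreal
    using that by (cases a; cases b) (auto simp: enn2ereal_ennreal)
  then show ?thesis
    unfolding ereal_expectation_def using fin
    by (simp add: real_lebesgue_integral_def[OF assms] e2ennreal_ereal)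
qed

text \<open>Where the divergence is finite, it agrees with the library's one, in nats.\<close>

lemma KL_density_eq_KL_divergence:
  fixes q p :: "'a::euclidean_space \<Rightarrow> real"
  assumes [measurable]: "q \<in> borel_measurable borel" "p \<in> borel_measurable borel"
    and nn: "\<And>w. 0 \<le> q w" "\<And>w. 0 \<le> p w"
    and ac: "AE w in lborel. p w = 0 \<longrightarrow> q w = 0"
    and int: "integrable lborel (\<lambda>w. q w * ln (q w / p w))"
  shows "KL_density q p = ereal (KL_divergence (exp 1) (density lborel p) (density lborel q))"
proof -
  have int': "integrable (density lborel q) (\<lambda>w. ln (q w / p w))"
    using int nn by (simp add: integrable_density)
  have "AE w in density lborel q. elog (q w) - elog (p w) = ereal (ln (q w / p w))"
    using ac by (auto simp: AE_density elog_def ln_div nn order.antisym elim!: eventually_mono)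
  then have "KL_density q p = ereal_expectation (density lborel q) (\<lambda>w. ereal (ln (q w / p w)))"
    unfolding KL_density_def ereal_expectation_def
    by (intro arg_cong2[where f="(-)"] arg_cong[where f=enn2ereal] nn_integral_cong_AE) auto
  also have "\<dots> = ereal (\<integral>w. q w * ln (q w / p w) \<partial>lborel)"
    using int' nn by (simp add: ereal_expectation_integrable integral_density)
  also have "(\<integral>w. q w * ln (q w / p w) \<partial>lborel)
      = KL_divergence (exp 1) (density lborel p) (density lborel q)"
    using ac nn
    by (subst lborel.KL_density_density) (auto simp: log_def)
  finally show ?thesis .
qed


section \<open>Elementary densities\<close>

text \<open>Circularly symmetric complex Gaussian with mean \<open>m\<close> and variance \<open>v\<close>, the expected
  squared modulus of the deviation from \<open>m\<close>; the reference measure is Lebesgue measure on the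
  plane.\<close>

definition complex_normal_density :: "complex \<Rightarrow> real \<Rightarrow> complex \<Rightarrow> real" where
  "complex_normal_density m v w = exp (- (cmod (w - m))\<^sup>2 / v) / (pi * v)"

definition uniform_density :: "real \<Rightarrow> real \<Rightarrow> real \<Rightarrow> real" where
  "uniform_density a b t = indicat_real {a<..<b} t / (b - a)"


section \<open>Transforms, variational density and entropy model\<close>

type_synonym ('c, 'h, 'w) image = "real ^ 'w ^ 'h ^ 'c"

text \<open>\<open>mean\<close> and \<open>std\<close> are the parameter functions of the entropy model of the latent given the
  hyperprior; the other fields are the transforms that compute latent, hyperprior and channel
  input.\<close>

record ('c, 'h, 'w, 'ny, 'nz, 'n) terminal =
  analysis :: "('c::finite, 'h::finite, 'w::finite) image \<Rightarrow> real ^ ('ny::finite)"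
  hyper_analysis :: "real ^ 'ny \<Rightarrow> real ^ ('nz::finite)"
  encoder :: "real ^ 'ny \<Rightarrow> complex ^ ('n::finite)"
  mean :: "real ^ 'nz \<Rightarrow> real ^ 'ny"
  std :: "real ^ 'nz \<Rightarrow> real ^ 'ny"

definition valid_terminal ::
  "('c::finite, 'h::finite, 'w::finite, 'ny::finite, 'nz::finite, 'n::finite) terminal \<Rightarrow> bool" where
  "valid_terminal T \<longleftrightarrow>
     analysis T \<in> borel_measurable borel \<and> hyper_analysis T \<in> borel_measurable borel \<and>
     encoder T \<in> borel_measurable borel \<and>
     mean T \<in> borel_measurable borel \<and> std T \<in> borel_measurable borel \<and>
     (\<forall>z j. 0 < std T z $ j)"

definition channel_input :: "('c::finite, 'h::finite, 'w::finite, 'ny::finite, 'nz::finite, 'n::finite) terminal \<Rightarrow>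
    ('c, 'h, 'w) image \<Rightarrow> complex ^ 'n" where
  "channel_input T x = encoder T (analysis T x)"

definition hyperprior :: "('c::finite, 'h::finite, 'w::finite, 'ny::finite, 'nz::finite, 'n::finite) terminal \<Rightarrow>
    ('c, 'h, 'w) image \<Rightarrow> real ^ 'nz" where
  "hyperprior T x = hyper_analysis T (analysis T x)"

text \<open>The arguments \<open>s1\<close>, \<open>s2\<close>, \<open>z1\<close>, \<open>z2\<close> are the channel outputs and the noisy
  hyperpriors.\<close>

definition variational_density ::
  "real \<Rightarrow> ('c::finite, 'h::finite, 'w::finite, 'ny::finite, 'nz::finite, 'n::finite) terminal \<Rightarrow>
   ('c, 'h, 'w, 'ny, 'nz, 'n) terminal \<Rightarrow> ('c, 'h, 'w) image \<times> ('c, 'h, 'w) image \<Rightarrow>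
   (complex ^ 'n) \<times> (complex ^ 'n) \<times> (real ^ 'nz) \<times> (real ^ 'nz) \<Rightarrow> real" where
  "variational_density \<epsilon> T1 T2 = (\<lambda>(x1, x2) (s1, s2, z1, z2).
     (\<Prod>k\<in>UNIV. complex_normal_density (channel_input T1 x1 $ k) (\<epsilon>\<^sup>2) (s1 $ k)) *
     (\<Prod>j\<in>UNIV. complex_normal_density (channel_input T2 x2 $ j) (\<epsilon>\<^sup>2) (s2 $ j)) *
     (\<Prod>m\<in>UNIV. uniform_density (hyperprior T1 x1 $ m - 1/2) (hyperprior T1 x1 $ m + 1/2) (z1 $ m)) *
     (\<Prod>l\<in>UNIV. uniform_density (hyperprior T2 x2 $ l - 1/2) (hyperprior T2 x2 $ l + 1/2) (z2 $ l)))"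

definition latent_density ::
  "('c::finite, 'h::finite, 'w::finite, 'ny::finite, 'nz::finite, 'n::finite) terminal \<Rightarrow>
   real ^ 'nz \<Rightarrow> real ^ 'ny \<Rightarrow> real" where
  "latent_density T z y = (\<Prod>j\<in>UNIV. normal_density (mean T z $ j) (std T z $ j) (y $ j))"

text \<open>Joint density, given the hyperprior \<open>z\<close>, of the latent \<open>y\<close> and of its noisy version
  \<open>y'\<close>, which is \<open>y\<close> plus independent standard uniform noise in each coordinate.\<close>

definition latent_pair_density ::
  "('c::finite, 'h::finite, 'w::finite, 'ny::finite, 'nz::finite, 'n::finite) terminal \<Rightarrow>
   real ^ 'nz \<Rightarrow> real ^ 'ny \<Rightarrow> real ^ 'ny \<Rightarrow> real" where
  "latent_pair_density T z y y' =
     latent_density T z y * (\<Prod>j\<in>UNIV. uniform_density (-1/2) (1/2) (y' $ j - y $ j))"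

definition noisy_latent_density ::
  "('c::finite, 'h::finite, 'w::finite, 'ny::finite, 'nz::finite, 'n::finite) terminal \<Rightarrow>
   real ^ 'nz \<Rightarrow> real ^ 'ny \<Rightarrow> real" where
  "noisy_latent_density T z y' = (\<Prod>j\<in>UNIV.
     \<integral>t. normal_density (mean T z $ j) (std T z $ j) t * uniform_density (-1/2) (1/2) (y' $ j - t) \<partial>lborel)"

lemma nn_integral_prod_vec:
  fixes f :: "'n::finite \<Rightarrow> real \<Rightarrow> ennreal"
  assumes "\<And>j. f j \<in> borel_measurable borel"
  shows "(\<integral>\<^sup>+y. (\<Prod>j\<in>UNIV. f j (y $ j)) \<partial>(lborel :: (real ^ 'n) measure))
       = (\<Prod>j\<in>UNIV. \<integral>\<^sup>+t. f j t \<partial>lborel)"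
proof -
  define g where "g b = f (inv_into UNIV (\<lambda>j. axis j (1::real)) b)" for b :: "real ^ 'n"
  have inj: "inj (\<lambda>j::'n. axis j (1::real))"
    by (auto simp: inj_on_def axis_eq_axis)
  have B: "Basis = range (\<lambda>j::'n. axis j (1::real))"
    by (auto simp: Basis_vec_def)
  have g: "g (axis j 1) = f j" for j
    unfolding g_def by (simp add: inv_f_f[OF inj])
  have P: "(\<Prod>b\<in>Basis. h b) = (\<Prod>j\<in>UNIV. h (axis j (1::real)))" for h :: "real ^ 'n \<Rightarrow> ennreal"
    unfolding B by (subst prod.reindex[OF inj]) simp
  have "(\<integral>\<^sup>+y. (\<Prod>b\<in>Basis. g b (y \<bullet> b)) \<partial>lborel) = (\<Prod>b\<in>Basis. \<integral>\<^sup>+t. g b t \<partial>lborel)"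
    using assms by (intro nn_integral_lborel_prod) (auto simp: g_def)
  then show ?thesis
    by (simp add: P g inner_axis)
qed

text \<open>The noisy latent thus has the conditional density
  \<open>\<Prod>j. (\<N>(\<mu>\<^sup>j, \<sigma>\<^sup>j) * \<U>(-1/2, 1/2))\<close>.\<close>

lemma nn_integral_latent_pair_density:
  assumes "valid_terminal T"
  shows "(\<integral>\<^sup>+y. ennreal (latent_pair_density T z y y') \<partial>lborel) = ennreal (noisy_latent_density T z y')"
proof -
  let ?f = "\<lambda>j t. normal_density (mean T z $ j) (std T z $ j) t * uniform_density (-1/2) (1/2) (y' $ j - t)"
  have nn: "0 \<le> ?f j t" for j t
    by (simp add: uniform_density_def)
  have meas: "?f j \<in> borel_measurable borel" for j
    unfolding uniform_density_def by measurable
  have int: "integrable lborel (?f j)" for j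
  proof (rule Bochner_Integration.integrable_bound)
    show "integrable lborel (normal_density (mean T z $ j) (std T z $ j))"
      using assms by (auto simp: valid_terminal_def)
    show "AE t in lborel. norm (?f j t) \<le> norm (normal_density (mean T z $ j) (std T z $ j) t)"
      by (auto simp: uniform_density_def indicator_def)
  qed (use meas in simp)
  have "(\<integral>\<^sup>+y. ennreal (latent_pair_density T z y y') \<partial>lborel)
      = (\<integral>\<^sup>+y. (\<Prod>j\<in>UNIV. ennreal (?f j (y $ j))) \<partial>lborel)"
    by (subst prod_ennreal[OF nn]) (simp add: latent_pair_density_def latent_density_def prod.distrib)
  also have "\<dots> = (\<Prod>j\<in>UNIV. \<integral>\<^sup>+t. ennreal (?f j t) \<partial>lborel)"
    using meas by (intro nn_integral_prod_vec) simp
  also have "\<dots> = (\<Prod>j\<in>UNIV. ennreal (\<integral>t. ?f j t \<partial>lborel))"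
    using int nn by (intro prod.cong refl nn_integral_eq_integral) auto
  also have "\<dots> = ennreal (noisy_latent_density T z y')"
    unfolding noisy_latent_density_def using nn
    by (intro prod_ennreal Bochner_Integration.integral_nonneg) auto
  finally show ?thesis .
qed

definition valid_hyper_density :: "((real ^ ('nz::finite)) \<times> (real ^ 'nz) \<Rightarrow> real) \<Rightarrow> bool" where
  "valid_hyper_density pz \<longleftrightarrow>
     pz \<in> borel_measurable borel \<and> (\<forall>z. 0 \<le> pz z) \<and> prob_space (density lborel pz)"


section \<open>Channel densities\<close>

definition noise_density :: "real \<Rightarrow> complex ^ ('n::finite) \<Rightarrow> real" where
  "noise_density \<epsilon> n = (\<Prod>k\<in>UNIV. complex_normal_density 0 (\<epsilon>\<^sup>2) (n $ k))"

text \<open>The channel input, a function of the latent, need not have a density given the hyperprior;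
  its conditional law is a measure, and its convolution with the Gaussian noise has a density.\<close>

definition channel_input_law ::
  "('c::finite, 'h::finite, 'w::finite, 'ny::finite, 'nz::finite, 'n::finite) terminal \<Rightarrow>
   real ^ 'nz \<Rightarrow> (complex ^ 'n) measure" where
  "channel_input_law T z = distr (density lborel (latent_density T z)) borel (encoder T)"

definition channel_output_density ::
  "real \<Rightarrow> ('c::finite, 'h::finite, 'w::finite, 'ny::finite, 'nz::finite, 'n::finite) terminal \<Rightarrow>
   real ^ 'nz \<Rightarrow> complex ^ 'n \<Rightarrow> real" where
  "channel_output_density \<epsilon> T z s' = (\<integral>s. noise_density \<epsilon> (s' - s) \<partial>channel_input_law T z)"


section \<open>The joint model\<close>

text \<open>Law of \<open>((y1, y2), (y1', y2'), (z1, z2))\<close> under the joint entropy model; primes mark the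
  noisy latents.\<close>

definition entropy_model ::
  "('c::finite, 'h::finite, 'w::finite, 'ny::finite, 'nz::finite, 'n::finite) terminal \<Rightarrow>
   ('c, 'h, 'w, 'ny, 'nz, 'n) terminal \<Rightarrow> ((real ^ 'nz) \<times> (real ^ 'nz) \<Rightarrow> real) \<Rightarrow>
   (((real ^ 'ny) \<times> (real ^ 'ny)) \<times> ((real ^ 'ny) \<times> (real ^ 'ny)) \<times> (real ^ 'nz) \<times> (real ^ 'nz)) measure" where
  "entropy_model T1 T2 pz = density lborel (\<lambda>((y1, y2), (y1', y2'), (z1, z2)).
     ennreal (pz (z1, z2) * latent_pair_density T1 z1 y1 y1' * latent_pair_density T2 z2 y2 y2'))"

text \<open>Law of the two channel outputs and the two noisy hyperpriors: the encoded latents are sent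
  over independent channels.\<close>

definition output_hyper_law ::
  "real \<Rightarrow> ('c::finite, 'h::finite, 'w::finite, 'ny::finite, 'nz::finite, 'n::finite) terminal \<Rightarrow>
   ('c, 'h, 'w, 'ny, 'nz, 'n) terminal \<Rightarrow> ((real ^ 'nz) \<times> (real ^ 'nz) \<Rightarrow> real) \<Rightarrow>
   ((complex ^ 'n) \<times> (complex ^ 'n) \<times> (real ^ 'nz) \<times> (real ^ 'nz)) measure" where
  "output_hyper_law \<epsilon> T1 T2 pz =
     distr (entropy_model T1 T2 pz \<Otimes>\<^sub>M (density lborel (noise_density \<epsilon>) \<Otimes>\<^sub>M density lborel (noise_density \<epsilon>)))
       borel
       (\<lambda>(((y1, y2), _, (z1, z2)), (n1, n2)). (encoder T1 y1 + n1, encoder T2 y2 + n2, z1, z2))"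

text \<open>\<open>p (x, w)\<close> is a joint density of the images \<open>x = (x1, x2)\<close> and of
  \<open>w = (s1, s2, z1, z2)\<close>. Its marginals are the data density and the law above; how \<open>x\<close>
  depends on \<open>w\<close> is not restricted.\<close>

definition joint_model ::
  "real \<Rightarrow> ('c::finite, 'h::finite, 'w::finite, 'ny::finite, 'nz::finite, 'n::finite) terminal \<Rightarrow>
   ('c, 'h, 'w, 'ny, 'nz, 'n) terminal \<Rightarrow> ((real ^ 'nz) \<times> (real ^ 'nz) \<Rightarrow> real) \<Rightarrow>
   (('c, 'h, 'w) image \<times> ('c, 'h, 'w) image \<Rightarrow> real) \<Rightarrow>
   ((('c, 'h, 'w) image \<times> ('c, 'h, 'w) image) \<times>
     ((complex ^ 'n) \<times> (complex ^ 'n) \<times> (real ^ 'nz) \<times> (real ^ 'nz)) \<Rightarrow> real) \<Rightarrow> bool" where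
  "joint_model \<epsilon> T1 T2 pz px p \<longleftrightarrow>
     p \<in> borel_measurable borel \<and> (\<forall>v. 0 \<le> p v) \<and>
     density lborel (\<lambda>x. \<integral>\<^sup>+w. ennreal (p (x, w)) \<partial>lborel) = density lborel px \<and>
     density lborel (\<lambda>w. \<integral>\<^sup>+x. ennreal (p (x, w)) \<partial>lborel) = output_hyper_law \<epsilon> T1 T2 pz"

text \<open>\<open>posterior p x w = p(w | x)\<close> and \<open>likelihood p x w = p(x | w)\<close>.\<close>

definition posterior :: "('a::euclidean_space \<times> 'b::euclidean_space \<Rightarrow> real) \<Rightarrow> 'a \<Rightarrow> 'b \<Rightarrow> real" where
  "posterior p x w = p (x, w) / (\<integral>w'. p (x, w') \<partial>lborel)"

definition likelihood :: "('a::euclidean_space \<times> 'b::euclidean_space \<Rightarrow> real) \<Rightarrow> 'a \<Rightarrow> 'b \<Rightarrow> real" where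
  "likelihood p x w = p (x, w) / (\<integral>x'. p (x', w) \<partial>lborel)"

end

theory Submission
  imports Defs
begin

text \<open>
  Write \<open>w = (s1, s2, z1, z2)\<close>. For almost every \<open>x\<close> the integrand of the divergence is
  \<open>- log p(x, w) + log q(w | x) + log p(x)\<close>. The law of \<open>w\<close> has the density
  \<open>p(z1, z2) p(s1 | z1) p(s2 | z2)\<close>, so the integrand on the right-hand side is
  \<open>- log p(x, w)\<close>. The difference does not depend on the model: \<open>q\<close> is a translate of one
  fixed density, hence its entropy is finite and independent of \<open>x\<close> and of the terminals, and
  \<open>log p(x)\<close> averages to minus the entropy of the data. All these terms being integrable, they can
  be split off even where the expectation of \<open>- log p(x, w)\<close> is infinite.
\<close>

section \<open>Extended-real expectations and integrals over products\<close>

lemma measurable_elog [measurable]: "elog \<in> borel_measurable borel"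
  unfolding elog_def[abs_def] by measurable

lemma ereal_expectation_cong_AE:
  assumes "AE x in M. f x = g x"
  shows "ereal_expectation M f = ereal_expectation M g"
  unfolding ereal_expectation_def using assms
  by (intro arg_cong2[where f="(-)"] arg_cong[where f=enn2ereal] nn_integral_cong_AE)
    (auto elim: eventually_mono)

text \<open>
  This includes the case that \<open>f\<close> has no expectation: if both its parts have infinite
  integral, then the same holds for \<open>f + h\<close>, and \<^term>\<open>\<infinity> - \<infinity> :: ereal\<close> is
  \<^term>\<open>\<infinity> :: ereal\<close>.
\<close>

lemma ereal_expectation_add_integrable:
  assumes f[measurable]: "f \<in> borel_measurable M" and h: "integrable M h"
  shows "ereal_expectation M (\<lambda>x. f x + ereal (h x))
    = ereal_expectation M f + ereal (\<integral>x. h x \<partial>M)"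
proof -
  have [measurable]: "h \<in> borel_measurable M" using h by auto
  let ?I = "\<lambda>g. \<integral>\<^sup>+x. e2ennreal (g x) \<partial>M"
  define A B P N hP hN where
    "A = ?I (\<lambda>x. f x + ereal (h x))" and "B = ?I (\<lambda>x. - (f x + ereal (h x)))"
    and "P = ?I f" and "N = ?I (\<lambda>x. - f x)"
    and "hP = (\<integral>\<^sup>+x. ennreal (h x) \<partial>M)" and "hN = (\<integral>\<^sup>+x. ennreal (- h x) \<partial>M)"
  note defs = this
  have fin: "hP \<noteq> \<infinity>" "hN \<noteq> \<infinity>"
    using h by (auto simp: real_integrable_def defs)
  \<comment> \<open>The last identity relates positive and negative parts without subtraction, so it
    can be integrated even when the integrals are infinite.\<close>
  have pt: "e2ennreal (a + ereal b) \<le> e2ennreal a + ennreal b"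
    "e2ennreal a \<le> e2ennreal (a + ereal b) + ennreal (- b)"
    "e2ennreal (- (a + ereal b)) \<le> e2ennreal (- a) + ennreal (- b)"
    "e2ennreal (- a) \<le> e2ennreal (- (a + ereal b)) + ennreal b"
    "e2ennreal (a + ereal b) + e2ennreal (- a) + ennreal (- b)
      = e2ennreal a + ennreal b + e2ennreal (- (a + ereal b))" for a b
    by (cases a; cases "0 \<le> b"; cases "0 \<le> real_of_ereal a"; cases "0 \<le> real_of_ereal a + b";
        force simp: e2ennreal_ereal ennreal_neg ennreal_plus[symmetric] intro!: ennreal_leI
          simp del: ennreal_plus)+
  \<comment> \<open>As \<open>hP\<close> and \<open>hN\<close> are finite, \<open>A\<close> is
    infinite exactly when \<open>P\<close> is, and \<open>B\<close> exactly when \<open>N\<close>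
    is; \<open>eq\<close> settles the finite case.\<close>
  have le: "A \<le> P + hP" "P \<le> A + hN" "B \<le> N + hN" "N \<le> B + hP"
    unfolding defs by (subst nn_integral_add[symmetric]; (intro nn_integral_mono pt)?; measurable)+
  have eq: "A + N + hN = P + hP + B"
    unfolding defs by (simp add: nn_integral_add[symmetric] pt)
  have int: "(\<integral>x. h x \<partial>M) = enn2real hP - enn2real hN"
    unfolding defs by (rule real_lebesgue_integral_def[OF h])
  have "enn2ereal A - enn2ereal B = enn2ereal P - enn2ereal N + ereal (enn2real hP - enn2real hN)"
    using le eq fin
    by (cases A; cases B; cases P; cases N; cases hP; cases hN)
      (auto simp: enn2ereal_ennreal ennreal_plus[symmetric] top_unique simp del: ennreal_plus)
  then show ?thesis
    by (simp add: ereal_expectation_def int defs)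
qed

lemma nn_integral_lborel_pair_mult:
  fixes f :: "'a::euclidean_space \<Rightarrow> ennreal" and g :: "'b::euclidean_space \<Rightarrow> ennreal"
  assumes [measurable]: "f \<in> borel_measurable borel" "g \<in> borel_measurable borel"
  shows "(\<integral>\<^sup>+w. f (fst w) * g (snd w) \<partial>lborel) = (\<integral>\<^sup>+x. f x \<partial>lborel) * (\<integral>\<^sup>+y. g y \<partial>lborel)"
  unfolding lborel_prod[symmetric]
  by (subst lborel.nn_integral_fst[symmetric]) (auto simp: nn_integral_cmult nn_integral_multc)


lemma borel_measurable_fst_borel [measurable (raw)]:
  fixes f :: "'m \<Rightarrow> 'a::second_countable_topology \<times> 'b::second_countable_topology"
  assumes "f \<in> borel_measurable M"
  shows "(\<lambda>x. fst (f x)) \<in> borel_measurable M"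
  using assms by (auto simp: borel_prod[symmetric])

lemma borel_measurable_snd_borel [measurable (raw)]:
  fixes f :: "'m \<Rightarrow> 'a::second_countable_topology \<times> 'b::second_countable_topology"
  assumes "f \<in> borel_measurable M"
  shows "(\<lambda>x. snd (f x)) \<in> borel_measurable M"
  using assms by (auto simp: borel_prod[symmetric])

section \<open>The noise densities and their entropy\<close>

lemma nn_integral_lborel_translate:
  fixes f :: "'a::euclidean_space \<Rightarrow> ennreal"
  assumes [measurable]: "f \<in> borel_measurable borel"
  shows "(\<integral>\<^sup>+x. f (x - c) \<partial>lborel) = (\<integral>\<^sup>+x. f x \<partial>lborel)"
  by (subst (2) lborel_distr_plus[of "- c", symmetric]) (simp add: nn_integral_distr)

lemma integrable_lborel_translate:
  fixes f :: "'a::euclidean_space \<Rightarrow> real"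
  assumes "integrable lborel f"
  shows "integrable lborel (\<lambda>x. f (x - c))"
  using assms borel_measurable_integrable[OF assms]
  by (subst (asm) lborel_distr_plus[of "- c", symmetric]) (simp add: integrable_distr_eq)

lemma integral_lborel_translate:
  fixes f :: "'a::euclidean_space \<Rightarrow> real"
  assumes [measurable]: "f \<in> borel_measurable borel"
  shows "(\<integral>x. f (x - c) \<partial>lborel) = (\<integral>x. f x \<partial>lborel)"
  by (subst (2) lborel_distr_plus[of "- c", symmetric]) (simp add: integral_distr)

lemma norm_sq_vec: "(norm x)\<^sup>2 = (\<Sum>i\<in>UNIV. (norm (x $ i))\<^sup>2)"
  by (simp add: norm_vec_def L2_set_def sum_nonneg)

lemma borel_measurable_vec_nth [measurable (raw)]:
  fixes f :: "'m \<Rightarrow> 'a::euclidean_space ^ 'n::finite"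
  assumes "f \<in> borel_measurable M"
  shows "(\<lambda>x. f x $ i) \<in> borel_measurable M"
  using assms by (rule measurable_compose)
    (intro borel_measurable_continuous_onI linear_continuous_on bounded_linear_vec_nth)

text \<open>In an orthonormal basis the squared norm is a sum, so the function is a product of
  one-dimensional normal densities. Each has variance \<open>v / 2\<close>, since the exponent of a
  normal density divides by twice the variance.\<close>

lemma nn_integral_gaussian:
  assumes "0 < v"
  shows "(\<integral>\<^sup>+x. ennreal (exp (- (norm x)\<^sup>2 / v) / sqrt (pi * v) ^ DIM('a)) \<partial>(lborel :: 'a::euclidean_space measure)) = 1"
proof -
  let ?g = "normal_density 0 (sqrt (v / 2))"
  have eq: "exp (- (norm x)\<^sup>2 / v) / sqrt (pi * v) ^ DIM('a) = (\<Prod>b\<in>Basis. ?g (x \<bullet> b))" for x :: 'a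
  proof -
    have "(norm x)\<^sup>2 = (\<Sum>b\<in>Basis. (x \<bullet> b)\<^sup>2)"
      by (subst power2_norm_eq_inner, subst euclidean_inner) (simp add: power2_eq_square)
    then show ?thesis
      using assms
      by (simp add: normal_density_def exp_sum prod_dividef sum_negf[symmetric] sum_divide_distrib real_sqrt_mult)
  qed
  have one: "(\<integral>\<^sup>+t. ennreal (?g t) \<partial>lborel) = 1"
    using assms by (subst nn_integral_eq_integral) auto
  show ?thesis
    unfolding eq
    by (simp add: prod_ennreal[symmetric] nn_integral_lborel_prod[of "\<lambda>_ t. ennreal (?g t)", simplified] one)
qed

lemma noise_density_eq:
  fixes s :: "complex ^ 'n::finite"
  shows "noise_density \<epsilon> s = exp (- (norm s)\<^sup>2 / \<epsilon>\<^sup>2) / (pi * \<epsilon>\<^sup>2) ^ CARD('n)"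
  by (simp add: noise_density_def complex_normal_density_def norm_sq_vec exp_sum prod_dividef
      sum_negf[symmetric] sum_divide_distrib)

lemma measurable_noise_density [measurable]: "noise_density \<epsilon> \<in> borel_measurable borel"
  unfolding noise_density_eq[abs_def] by measurable

lemma noise_density_pos: "0 < \<epsilon> \<Longrightarrow> 0 < noise_density \<epsilon> s"
  by (simp add: noise_density_eq)

lemma noise_density_le:
  fixes s :: "complex ^ 'n::finite"
  shows "0 < \<epsilon> \<Longrightarrow> noise_density \<epsilon> s \<le> 1 / (pi * \<epsilon>\<^sup>2) ^ CARD('n)"
  by (simp add: noise_density_eq divide_right_mono)

lemma nn_integral_noise_density:
  assumes "0 < \<epsilon>"
  shows "(\<integral>\<^sup>+s. ennreal (noise_density \<epsilon> s) \<partial>(lborel :: (complex ^ 'n::finite) measure)) = 1"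
proof -
  \<comment> \<open>As a real space, \<open>complex ^ 'n\<close> has dimension
    \<open>2 * CARD('n)\<close>, which absorbs the square root.\<close>
  have "sqrt (pi * \<epsilon>\<^sup>2) ^ DIM(complex ^ 'n) = (pi * \<epsilon>\<^sup>2) ^ CARD('n)"
    by (simp add: mult.commute[of _ 2] power_mult)
  with nn_integral_gaussian[of "\<epsilon>\<^sup>2", where 'a="complex ^ 'n"] assms show ?thesis
    by (simp add: noise_density_eq)
qed

text \<open>The root halves the exponent, which doubles the variance; the factor exchanges the two
  normalisations.\<close>

lemma sqrt_noise_density:
  fixes s :: "complex ^ 'n::finite"
  assumes "0 < \<epsilon>"
  shows "sqrt (noise_density \<epsilon> s)
    = (2 * pi * \<epsilon>\<^sup>2) ^ CARD('n) / sqrt ((pi * \<epsilon>\<^sup>2) ^ CARD('n)) * noise_density (sqrt 2 * \<epsilon>) s"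
proof -
  have "sqrt (exp t) = exp (t / 2)" for t :: real
    by (rule real_sqrt_unique) (simp_all add: power2_eq_square exp_add[symmetric])
  then show ?thesis
    using assms
    by (simp add: noise_density_eq real_sqrt_divide power_mult_distrib mult.commute mult.left_commute)
qed

definition unit_cube_density :: "real ^ 'n::finite \<Rightarrow> real" where
  "unit_cube_density z = (\<Prod>m\<in>UNIV. uniform_density (-1/2) (1/2) (z $ m))"

lemma measurable_uniform_density [measurable]: "uniform_density a b \<in> borel_measurable borel"
  unfolding uniform_density_def[abs_def] by measurable

lemma measurable_unit_cube_density [measurable]: "unit_cube_density \<in> borel_measurable borel"
  unfolding unit_cube_density_def[abs_def] by measurable

text \<open>The interval has length 1, so each factor is 0 or 1. Such a function is its own square
  root, which makes the cube factors harmless in the entropy bound.\<close>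

lemma unit_cube_density_cases: "unit_cube_density z = 0 \<or> unit_cube_density z = 1"
proof (cases "\<forall>m. uniform_density (-1/2) (1/2) (z $ m) = 1")
  case False
  then obtain m where "uniform_density (-1/2) (1/2) (z $ m) = 0"
    by (auto simp: uniform_density_def indicator_def split: if_splits)
  then show ?thesis
    unfolding unit_cube_density_def by (metis UNIV_I finite_class.finite_UNIV prod_zero)
qed (simp add: unit_cube_density_def)

lemma nn_integral_unit_cube_density:
  "(\<integral>\<^sup>+z. ennreal (unit_cube_density z) \<partial>(lborel :: (real ^ 'n::finite) measure)) = 1"
proof -
  have "(\<integral>\<^sup>+t. ennreal (uniform_density (-1/2) (1/2) t) \<partial>lborel) = 1"
    by (simp add: uniform_density_def ennreal_indicator)
  moreover have "0 \<le> uniform_density (-1/2) (1/2) t" for t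
    by (simp add: uniform_density_def)
  ultimately show ?thesis
    unfolding unit_cube_density_def
    by (simp add: prod_ennreal[symmetric]
        nn_integral_prod_vec[of "\<lambda>_ t. ennreal (uniform_density (-1/2) (1/2) t)", simplified])
qed

text \<open>The law, under the variational density, of the deviation of
  \<open>(s1, s2, z1, z2)\<close> from its noiseless values. It involves neither the images nor the
  terminals.\<close>

definition joint_noise_density ::
  "real \<Rightarrow> (complex ^ 'n::finite) \<times> (complex ^ 'n) \<times> (real ^ 'nz::finite) \<times> (real ^ 'nz) \<Rightarrow> real" where
  "joint_noise_density \<epsilon> = (\<lambda>(s1, s2, z1, z2).
     noise_density \<epsilon> s1 * noise_density \<epsilon> s2 * unit_cube_density z1 * unit_cube_density z2)"

lemma measurable_joint_noise_density [measurable]: "joint_noise_density \<epsilon> \<in> borel_measurable borel"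
  unfolding joint_noise_density_def split_beta' by measurable

lemma unit_cube_density_nonneg [simp]: "0 \<le> unit_cube_density z"
  using unit_cube_density_cases[of z] by auto

lemma noise_density_nonneg [simp]: "0 \<le> noise_density \<epsilon> s"
  by (simp add: noise_density_eq)

lemma joint_noise_density_nonneg [simp]: "0 \<le> joint_noise_density \<epsilon> w"
  by (simp add: joint_noise_density_def split_beta)

lemma nn_integral_joint_noise_density:
  assumes "0 < \<epsilon>"
  shows "(\<integral>\<^sup>+w. ennreal (joint_noise_density \<epsilon> w)
    \<partial>(lborel :: ((complex ^ 'n::finite) \<times> (complex ^ 'n) \<times> (real ^ 'nz::finite) \<times> (real ^ 'nz)) measure)) = 1"
proof -
  let ?N = "\<lambda>s :: complex ^ 'n. ennreal (noise_density \<epsilon> s)"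
  let ?U = "\<lambda>z :: real ^ 'nz. ennreal (unit_cube_density z)"
  let ?UU = "\<lambda>z. ?U (fst z) * ?U (snd z)"
  let ?NUU = "\<lambda>u. ?N (fst u) * ?UU (snd u)"
  have "ennreal (joint_noise_density \<epsilon> w) = ?N (fst w) * ?NUU (snd w)" for w
    by (simp add: joint_noise_density_def split_beta ennreal_mult' mult.assoc)
  then show ?thesis
    using nn_integral_lborel_pair_mult[of ?N ?NUU] nn_integral_lborel_pair_mult[of ?N ?UU]
      nn_integral_lborel_pair_mult[of ?U ?U]
    by (simp add: nn_integral_noise_density[OF assms] nn_integral_unit_cube_density)
qed

lemma integrable_joint_noise_density:
  assumes "0 < \<epsilon>"
  shows "integrable lborel (joint_noise_density \<epsilon>)"
  by (rule integrableI_nonneg) (auto simp: nn_integral_joint_noise_density assms)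

text \<open>Both sides come from \<open>ln u \<le> u - 1\<close>, at \<open>u = t\<close> for the
  upper bound and at \<open>u = 1 / sqrt t\<close> for the lower one. Taking
  \<open>u = 1 / t\<close> instead would give the bound \<open>1 - t\<close>, which does not decay
  with the density.\<close>

lemma abs_mult_ln_le:
  assumes "0 \<le> (t::real)"
  shows "\<bar>t * ln t\<bar> \<le> t\<^sup>2 + 2 * sqrt t"
proof (cases "t = 0")
  case False
  with assms have t: "0 < t" by simp
  have "ln t \<le> t" using ln_le_minus_one[OF t] by simp
  then have 1: "t * ln t \<le> t\<^sup>2" using t by (simp add: power2_eq_square)
  have "- ln t = 2 * ln (1 / sqrt t)"
    using t by (simp add: ln_div ln_sqrt)
  also have "\<dots> \<le> 2 * (1 / sqrt t)"
    using ln_le_minus_one[of "1 / sqrt t"] t by simp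
  finally have "t * (- ln t) \<le> t * (2 * (1 / sqrt t))"
    using t by (intro mult_left_mono) auto
  also have "\<dots> = 2 * sqrt t"
    using real_div_sqrt[of t] t by (simp add: field_simps)
  finally have 2: "- (t * ln t) \<le> 2 * sqrt t" by simp
  have "0 \<le> t\<^sup>2" "0 \<le> sqrt t" using t by auto
  with 1 2 show ?thesis by linarith
qed simp

text \<open>
  \<open>\<bar>t ln t\<bar> \<le> t\<^sup>2 + 2 sqrt t\<close> reduces the claim to the density, which is bounded, and its square
  root, which is a multiple of the same density with twice the noise variance.
\<close>

lemma integrable_joint_noise_entropy:
  fixes \<rho> :: "(complex ^ 'n::finite) \<times> (complex ^ 'n) \<times> (real ^ 'nz::finite) \<times> (real ^ 'nz) \<Rightarrow> real"
  assumes "0 < \<epsilon>" and \<rho>: "\<rho> = joint_noise_density \<epsilon>"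
  shows "integrable lborel (\<lambda>w. \<rho> w * ln (\<rho> w))"
proof (rule Bochner_Integration.integrable_bound)
  let ?\<rho>' = "joint_noise_density (sqrt 2 * \<epsilon>) :: (complex ^ 'n) \<times> (complex ^ 'n) \<times> (real ^ 'nz) \<times> (real ^ 'nz) \<Rightarrow> real"
  \<comment> \<open>\<open>K\<close> bounds one Gaussian factor and \<open>C\<close> is the factor
    of \<open>sqrt_noise_density\<close>; with two terminals both appear squared.\<close>
  define K where "K = 1 / (pi * \<epsilon>\<^sup>2) ^ CARD('n)"
  define C where "C = (2 * pi * \<epsilon>\<^sup>2) ^ CARD('n) / sqrt ((pi * \<epsilon>\<^sup>2) ^ CARD('n))"
  have K: "0 \<le> K" by (simp add: K_def)
  show "integrable lborel (\<lambda>w. K\<^sup>2 * \<rho> w + 2 * C\<^sup>2 * ?\<rho>' w)"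
    unfolding \<rho> using assms by (intro Bochner_Integration.integrable_add integrable_mult_right integrable_joint_noise_density) auto
  have bound: "\<bar>\<rho> w * ln (\<rho> w)\<bar> \<le> K\<^sup>2 * \<rho> w + 2 * C\<^sup>2 * ?\<rho>' w" for w
  proof -
    obtain s1 s2 z1 z2 where w: "w = (s1, s2, z1, z2)" by (metis surj_pair)
    have cube: "sqrt (unit_cube_density z) = unit_cube_density z" "unit_cube_density z \<le> 1"
      for z :: "real ^ 'nz"
      using unit_cube_density_cases[of z] by auto
    have sq: "sqrt (noise_density \<epsilon> s) = C * noise_density (sqrt 2 * \<epsilon>) s" for s :: "complex ^ 'n"
      unfolding C_def by (rule sqrt_noise_density[OF assms(1)])
    have "sqrt (\<rho> w) = C\<^sup>2 * ?\<rho>' w"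
      by (simp add: w \<rho> joint_noise_density_def real_sqrt_mult sq cube power2_eq_square)
    moreover have "\<rho> w \<le> K * K * 1 * 1"
      unfolding w \<rho> joint_noise_density_def prod.case K_def using assms K[unfolded K_def]
      by (intro mult_mono noise_density_le cube) (auto intro!: mult_nonneg_nonneg)
    then have "(\<rho> w)\<^sup>2 \<le> K\<^sup>2 * \<rho> w"
      by (simp add: power2_eq_square mult_right_mono \<rho>)
    ultimately show ?thesis
      using abs_mult_ln_le[of "\<rho> w"] \<rho> by simp
  qed
  then show "AE w in lborel. norm (\<rho> w * ln (\<rho> w)) \<le> norm (K\<^sup>2 * \<rho> w + 2 * C\<^sup>2 * ?\<rho>' w)"
    by (intro AE_I2) (metis abs_ge_self order_trans real_norm_def)
qed (simp add: \<rho>)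

text \<open>The noiseless values, around which the variational density is centred.\<close>

definition terminal_outputs ::
  "('c::finite, 'h::finite, 'w::finite, 'ny::finite, 'nz::finite, 'n::finite) terminal \<Rightarrow>
   ('c, 'h, 'w, 'ny, 'nz, 'n) terminal \<Rightarrow> ('c, 'h, 'w) image \<times> ('c, 'h, 'w) image \<Rightarrow>
   (complex ^ 'n) \<times> (complex ^ 'n) \<times> (real ^ 'nz) \<times> (real ^ 'nz)" where
  "terminal_outputs T1 T2 x =
     (channel_input T1 (fst x), channel_input T2 (snd x), hyperprior T1 (fst x), hyperprior T2 (snd x))"

text \<open>Gaussian and uniform factors depend only on the argument minus the centre, so all
  centres combine into one translation of \<open>w\<close>.\<close>

lemma variational_density_eq:
  "variational_density \<epsilon> T1 T2 x w = joint_noise_density \<epsilon> (w - terminal_outputs T1 T2 x)"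
proof -
  have u: "uniform_density (a - 1/2) (a + 1/2) t = uniform_density (-1/2) (1/2) (t - a)" for a t
    by (auto simp: uniform_density_def indicator_def)
  show ?thesis
    by (simp add: variational_density_def joint_noise_density_def noise_density_def
        unit_cube_density_def terminal_outputs_def complex_normal_density_def u split_beta)
qed

lemma measurable_terminal_outputs:
  assumes "valid_terminal T1" "valid_terminal T2"
  shows "terminal_outputs T1 T2 \<in> borel_measurable borel"
proof -
  have [measurable]: "analysis T1 \<in> borel_measurable borel" "analysis T2 \<in> borel_measurable borel"
    "hyper_analysis T1 \<in> borel_measurable borel" "hyper_analysis T2 \<in> borel_measurable borel"
    "encoder T1 \<in> borel_measurable borel" "encoder T2 \<in> borel_measurable borel"
    using assms by (auto simp: valid_terminal_def)
  show ?thesis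
    unfolding terminal_outputs_def[abs_def] channel_input_def hyperprior_def by measurable
qed

section \<open>The density of the channel outputs and hyperpriors\<close>

lemma nn_integral_lborel_pair:
  fixes f :: "'a::euclidean_space \<times> 'b::euclidean_space \<Rightarrow> ennreal"
  assumes "f \<in> borel_measurable borel"
  shows "(\<integral>\<^sup>+w. f w \<partial>lborel) = (\<integral>\<^sup>+x. \<integral>\<^sup>+y. f (x, y) \<partial>lborel \<partial>lborel)"
  using lborel.nn_integral_fst[of f lborel] assms by (simp add: lborel_prod)

lemma nn_integral_lborel_swap:
  fixes f :: "'a::euclidean_space \<Rightarrow> 'b::euclidean_space \<Rightarrow> ennreal"
  assumes "(\<lambda>(x, y). f x y) \<in> borel_measurable borel"
  shows "(\<integral>\<^sup>+x. \<integral>\<^sup>+y. f x y \<partial>lborel \<partial>lborel) = (\<integral>\<^sup>+y. \<integral>\<^sup>+x. f x y \<partial>lborel \<partial>lborel)"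
  using lborel_pair.Fubini'[of f] assms by (simp add: lborel_prod)

text \<open>Serves to merge channel outputs \<open>S\<close> and hyperpriors \<open>Z\<close> into
  one right-nested tuple \<open>w\<close>, the form in which the output law is stated.\<close>

lemma nn_integral_lborel_regroup:
  fixes f :: "'a::euclidean_space \<times> 'b::euclidean_space \<Rightarrow> 'c::euclidean_space \<Rightarrow> ennreal"
  assumes "(\<lambda>(S, Z). f S Z) \<in> borel_measurable borel"
  shows "(\<integral>\<^sup>+Z. \<integral>\<^sup>+S. f S Z \<partial>lborel \<partial>lborel)
    = (\<integral>\<^sup>+w. f (fst w, fst (snd w)) (snd (snd w)) \<partial>lborel)"
proof -
  have [measurable]: "(\<lambda>x. f (g x) (h x)) \<in> borel_measurable M"
    if [measurable]: "g \<in> borel_measurable M" "h \<in> borel_measurable M"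
    for g h and M :: "'m measure"
    using measurable_compose[OF borel_measurable_Pair assms, of g M h] that by simp
  show ?thesis
    by (subst nn_integral_lborel_swap) (simp_all add: nn_integral_lborel_pair split_beta')
qed

lemma latent_pair_density_eq:
  "latent_pair_density T z y y' = latent_density T z y * unit_cube_density (y' - y)"
  by (simp add: latent_pair_density_def unit_cube_density_def)

context
  fixes T :: "('c::finite, 'h::finite, 'w::finite, 'ny::finite, 'nz::finite, 'n::finite) terminal"
  assumes T: "valid_terminal T"
begin

lemma measurable_latent_density:
  assumes [measurable]: "f \<in> borel_measurable M" "g \<in> borel_measurable M"
  shows "(\<lambda>x. latent_density T (f x) (g x)) \<in> borel_measurable M"
proof -
  have [measurable]: "mean T \<in> borel_measurable borel" "std T \<in> borel_measurable borel"
    using T by (auto simp: valid_terminal_def)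
  show ?thesis
    unfolding latent_density_def normal_density_def by measurable
qed

lemma latent_density_pos: "0 < latent_density T z y"
  using T unfolding latent_density_def valid_terminal_def by (auto intro!: prod_pos normal_density_pos)

lemma nn_integral_latent_density: "(\<integral>\<^sup>+y. ennreal (latent_density T z y) \<partial>lborel) = 1"
proof -
  have "(\<integral>\<^sup>+t. ennreal (normal_density (mean T z $ j) (std T z $ j) t) \<partial>lborel) = 1" for j
    using T by (subst nn_integral_eq_integral) (auto simp: valid_terminal_def)
  then show ?thesis
    using nn_integral_prod_vec[of "\<lambda>j t. ennreal (normal_density (mean T z $ j) (std T z $ j) t)"]
    by (simp add: latent_density_def prod_ennreal[symmetric])
qed

lemma measurable_encoder: "encoder T \<in> borel_measurable borel"
  using T by (simp add: valid_terminal_def)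

context
  fixes \<epsilon> :: real
  assumes \<epsilon>: "0 < \<epsilon>"
begin

text \<open>The noise density is bounded and the latent law is a probability, so the Bochner
  integral of the definition agrees with the nonnegative one. Pulling back along the encoder
  replaces the law of the channel input by that of the latent.\<close>

lemma ennreal_channel_output_density:
  "ennreal (channel_output_density \<epsilon> T z s)
    = (\<integral>\<^sup>+y. ennreal (latent_density T z y) * ennreal (noise_density \<epsilon> (s - encoder T y)) \<partial>lborel)"
proof -
  note [measurable] = measurable_latent_density measurable_encoder
  let ?D = "density lborel (\<lambda>y. ennreal (latent_density T z y))"
  interpret prob_space ?D
    by (rule prob_spaceI) (simp add: emeasure_density nn_integral_latent_density)
  have "integrable ?D (\<lambda>y. noise_density \<epsilon> (s - encoder T y))"
    by (rule integrable_const_bound[where B="1 / (pi * \<epsilon>\<^sup>2) ^ CARD('n)"])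
      (auto simp: noise_density_le \<epsilon>)
  then have "(\<integral>\<^sup>+y. ennreal (noise_density \<epsilon> (s - encoder T y)) \<partial>?D)
      = ennreal (\<integral>y. noise_density \<epsilon> (s - encoder T y) \<partial>?D)"
    by (intro nn_integral_eq_integral) auto
  also have "(\<integral>y. noise_density \<epsilon> (s - encoder T y) \<partial>?D) = channel_output_density \<epsilon> T z s"
    unfolding channel_output_density_def channel_input_law_def
    by (subst integral_distr) auto
  finally show ?thesis
    by (simp add: nn_integral_density)
qed

text \<open>A zero integral would force the integrand, a product of positive factors, to vanish
  almost everywhere. Positivity makes the logarithms of the channel densities finite, so no
  \<open>\<infinity> - \<infinity>\<close> arises from them.\<close>

lemma channel_output_density_pos: "0 < channel_output_density \<epsilon> T z s"
proof (rule ccontr)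
  note [measurable] = measurable_latent_density measurable_encoder
  assume "\<not> ?thesis"
  then have "(\<integral>\<^sup>+y. ennreal (latent_density T z y) * ennreal (noise_density \<epsilon> (s - encoder T y)) \<partial>lborel) = 0"
    by (simp add: ennreal_channel_output_density[symmetric] ennreal_neg)
  then have "AE y in lborel. ennreal (latent_density T z y) * ennreal (noise_density \<epsilon> (s - encoder T y)) = 0"
    by (subst (asm) nn_integral_0_iff_AE) auto
  moreover have "ennreal (latent_density T z y) * ennreal (noise_density \<epsilon> (s - encoder T y)) \<noteq> 0" for y
    using latent_density_pos[of z y] noise_density_pos[OF \<epsilon>, of "s - encoder T y"]
    by (simp add: ennreal_eq_0_iff)
  ultimately have "AE y in (lborel :: (real ^ 'ny) measure). False"
    by simp
  then show False
    by (simp add: AE_iff_measurable[of UNIV])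
qed

text \<open>As a nonnegative integral over \<open>lborel\<close>, the density has its parameters in
  the integrand alone, and parametrised integrals are measurable.\<close>

lemma measurable_channel_output_density:
  assumes [measurable]: "f \<in> borel_measurable M" "g \<in> borel_measurable M"
  shows "(\<lambda>x. channel_output_density \<epsilon> T (f x) (g x)) \<in> borel_measurable M"
proof -
  note [measurable] = measurable_latent_density measurable_encoder
  have "channel_output_density \<epsilon> T z s = enn2real (\<integral>\<^sup>+y. ennreal (latent_density T z y) *
      ennreal (noise_density \<epsilon> (s - encoder T y)) \<partial>lborel)" for z s
    using channel_output_density_pos[of z s]
    by (simp add: ennreal_channel_output_density[symmetric])
  then show ?thesis
    by simp
qed

end

end

definition output_hyper_density ::
  "real \<Rightarrow> ('c::finite, 'h::finite, 'w::finite, 'ny::finite, 'nz::finite, 'n::finite) terminal \<Rightarrow>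
   ('c, 'h, 'w, 'ny, 'nz, 'n) terminal \<Rightarrow> ((real ^ 'nz) \<times> (real ^ 'nz) \<Rightarrow> real) \<Rightarrow>
   (complex ^ 'n) \<times> (complex ^ 'n) \<times> (real ^ 'nz) \<times> (real ^ 'nz) \<Rightarrow> real" where
  "output_hyper_density \<epsilon> T1 T2 pz = (\<lambda>(s1, s2, z1, z2).
     pz (z1, z2) * channel_output_density \<epsilon> T1 z1 s1 * channel_output_density \<epsilon> T2 z2 s2)"

lemma measurable_output_hyper_density:
  assumes "valid_terminal T1" "valid_terminal T2" "valid_hyper_density pz" "0 < \<epsilon>"
  shows "output_hyper_density \<epsilon> T1 T2 pz \<in> borel_measurable borel"
proof -
  note [measurable] = measurable_channel_output_density[OF assms(1,4)]
    measurable_channel_output_density[OF assms(2,4)]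
  have [measurable]: "pz \<in> borel_measurable borel"
    using assms by (simp add: valid_hyper_density_def)
  show ?thesis
    unfolding output_hyper_density_def split_beta' by measurable
qed

text \<open>The measure of a set is an iterated integral over latents, noisy latents, hyperpriors
  and noise. Shifting the noise by the encoded latents makes it the channel output; once
  \<open>w\<close> is outermost, the noisy latents integrate to 1 and the two latents
  separate.\<close>

lemma output_hyper_law_eq_density:
  fixes T1 T2 :: "('c::finite, 'h::finite, 'w::finite, 'ny::finite, 'nz::finite, 'n::finite) terminal"
  assumes "valid_terminal T1" "valid_terminal T2" "valid_hyper_density pz" "0 < \<epsilon>"
  shows "output_hyper_law \<epsilon> T1 T2 pz = density lborel (\<lambda>w. ennreal (output_hyper_density \<epsilon> T1 T2 pz w))"
proof (rule measure_eqI)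
  show "sets (output_hyper_law \<epsilon> T1 T2 pz)
      = sets (density lborel (\<lambda>w. ennreal (output_hyper_density \<epsilon> T1 T2 pz w)))"
    by (simp add: output_hyper_law_def)
  fix A assume "A \<in> sets (output_hyper_law \<epsilon> T1 T2 pz)"
  then have A[measurable]: "A \<in> sets borel"
    by (simp add: output_hyper_law_def)
  note T = assms(1,2) and \<epsilon> = assms(4)
  note [measurable] = T[THEN measurable_latent_density] T[THEN measurable_encoder]
    measurable_output_hyper_density[OF assms]
  have pz[measurable]: "pz \<in> borel_measurable borel" and pz0: "\<And>z. 0 \<le> pz z"
    using assms by (auto simp: valid_hyper_density_def)
  let ?G = "density lborel (noise_density \<epsilon>) :: (complex ^ 'n) measure"
  \<comment> \<open>Capitals denote pairs over the two terminals: \<open>S\<close> noise or channel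
    outputs, \<open>Y\<close> latents, \<open>Y'\<close> noisy latents, \<open>Z\<close>
    hyperpriors. \<open>?F\<close> is the integrand after the shift.\<close>
  let ?N = "\<lambda>S :: (complex ^ 'n) \<times> (complex ^ 'n). ennreal (noise_density \<epsilon> (fst S)) * ennreal (noise_density \<epsilon> (snd S))"
  let ?L = "\<lambda>Z Y. ennreal (latent_density T1 (fst Z) (fst Y)) * ennreal (latent_density T2 (snd Z) (snd Y))"
  let ?U = "\<lambda>Y. ennreal (unit_cube_density (fst Y)) * ennreal (unit_cube_density (snd Y))"
  let ?enc = "\<lambda>Y. (encoder T1 (fst Y), encoder T2 (snd Y))"
  let ?I = "\<lambda>S Z. indicator A (fst S, snd S, Z) :: ennreal"
  let ?E = "\<lambda>(Y, Y', Z). ennreal (pz Z) * (?L Z Y * ?U (Y' - Y))"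
  let ?F = "\<lambda>Y Y' S Z. ennreal (pz Z) * (?L Z Y * ?U (Y' - Y)) * ?N (S - ?enc Y) * ?I S Z"
  have U: "(\<integral>\<^sup>+Y. ?U Y \<partial>lborel) = 1"
    using nn_integral_lborel_pair_mult[of "\<lambda>y. ennreal (unit_cube_density y)" "\<lambda>y. ennreal (unit_cube_density y)"]
    by (simp add: nn_integral_unit_cube_density)
  have U_shift: "(\<integral>\<^sup>+Y'. ?U (Y' - Y) \<partial>lborel) = 1" for Y
    using nn_integral_lborel_translate[of ?U Y] U by simp
  have E: "entropy_model T1 T2 pz = density lborel ?E"
    unfolding entropy_model_def
    by (intro arg_cong[where f="density lborel"] ext)
      (simp add: split_beta latent_pair_density_eq
        ennreal_mult' ennreal_mult'' pz0 less_imp_le[OF latent_density_pos] T mult_ac)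
  have prob: "prob_space ?G"
    by (rule prob_spaceI) (simp add: emeasure_density nn_integral_noise_density \<epsilon>)
  have N: "?G \<Otimes>\<^sub>M ?G = density lborel ?N"
    using prob_space_imp_sigma_finite[OF prob]
    by (subst pair_measure_density) (auto simp: lborel_prod split_beta' intro: sigma_finite_lborel)
  have probN: "prob_space (density lborel ?N)"
    unfolding N[symmetric] using prob by (intro prob_space_pair)
  have "entropy_model T1 T2 pz \<Otimes>\<^sub>M (?G \<Otimes>\<^sub>M ?G)
      = density lborel (\<lambda>(e, n). ?E e * ?N n)"
    unfolding E N using prob_space_imp_sigma_finite[OF probN]
    by (subst pair_measure_density) (auto simp: lborel_prod intro: sigma_finite_lborel)
  then have law: "output_hyper_law \<epsilon> T1 T2 pz = distr (density lborel (\<lambda>(e, n). ?E e * ?N n)) borel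
      (\<lambda>(((y1, y2), _, (z1, z2)), (n1, n2)). (encoder T1 y1 + n1, encoder T2 y2 + n2, z1, z2))"
    unfolding output_hyper_law_def by simp
  have "emeasure (output_hyper_law \<epsilon> T1 T2 pz) A
     = (\<integral>\<^sup>+v. (\<lambda>(e, n). ?E e * ?N n) v * ?I (?enc (fst (fst v)) + snd v) (snd (snd (fst v))) \<partial>lborel)"
    unfolding law
    by (subst nn_integral_indicator[symmetric])
      (simp_all add: nn_integral_distr nn_integral_density split_beta' del: nn_integral_indicator)
  also have "\<dots> = (\<integral>\<^sup>+Y. \<integral>\<^sup>+Y'. \<integral>\<^sup>+Z. \<integral>\<^sup>+S. ennreal (pz Z) * (?L Z Y * ?U (Y' - Y)) * ?N S * ?I (?enc Y + S) Z
      \<partial>lborel \<partial>lborel \<partial>lborel \<partial>lborel)"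
    by (simp add: nn_integral_lborel_pair split_beta')
  \<comment> \<open>From here on \<open>S\<close> is the channel output instead of the
    noise.\<close>
  also have "\<dots> = (\<integral>\<^sup>+Y. \<integral>\<^sup>+Y'. \<integral>\<^sup>+Z. \<integral>\<^sup>+S. ?F Y Y' S Z \<partial>lborel \<partial>lborel \<partial>lborel \<partial>lborel)"
  proof (rule nn_integral_cong, rule nn_integral_cong, rule nn_integral_cong)
    fix Y Y' Z
    show "(\<integral>\<^sup>+S. ennreal (pz Z) * (?L Z Y * ?U (Y' - Y)) * ?N S * ?I (?enc Y + S) Z \<partial>lborel)
        = (\<integral>\<^sup>+S. ?F Y Y' S Z \<partial>lborel)"
      using nn_integral_lborel_translate[of "\<lambda>S. ?F Y Y' S Z" "- ?enc Y"]
      by (simp add: add.commute)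
  qed
  also have "\<dots> = (\<integral>\<^sup>+Y. \<integral>\<^sup>+Y'. \<integral>\<^sup>+w. ?F Y Y' (fst w, fst (snd w)) (snd (snd w)) \<partial>lborel \<partial>lborel \<partial>lborel)"
    by (intro nn_integral_cong nn_integral_lborel_regroup) (simp add: split_beta')
  also have "\<dots> = (\<integral>\<^sup>+Y. \<integral>\<^sup>+w. \<integral>\<^sup>+Y'. ?F Y Y' (fst w, fst (snd w)) (snd (snd w)) \<partial>lborel \<partial>lborel \<partial>lborel)"
    by (intro nn_integral_cong nn_integral_lborel_swap) (simp add: split_beta')
  also have "\<dots> = (\<integral>\<^sup>+w. \<integral>\<^sup>+Y. \<integral>\<^sup>+Y'. ?F Y Y' (fst w, fst (snd w)) (snd (snd w)) \<partial>lborel \<partial>lborel \<partial>lborel)"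
    by (intro nn_integral_lborel_swap) (simp add: split_beta')
  also have "\<dots> = (\<integral>\<^sup>+w. ennreal (output_hyper_density \<epsilon> T1 T2 pz w) * indicator A w \<partial>lborel)"
  proof (intro nn_integral_cong)
    fix w :: "(complex ^ 'n) \<times> (complex ^ 'n) \<times> (real ^ 'nz) \<times> (real ^ 'nz)"
    obtain s1 s2 z1 z2 where w: "w = (s1, s2, z1, z2)" by (metis surj_pair)
    let ?c = "ennreal (pz (z1, z2)) * indicator A w"
    let ?g1 = "\<lambda>y. ennreal (latent_density T1 z1 y) * ennreal (noise_density \<epsilon> (s1 - encoder T1 y))"
    let ?g2 = "\<lambda>y. ennreal (latent_density T2 z2 y) * ennreal (noise_density \<epsilon> (s2 - encoder T2 y))"
    have "(\<integral>\<^sup>+Y. \<integral>\<^sup>+Y'. ?F Y Y' (s1, s2) (z1, z2) \<partial>lborel \<partial>lborel)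
        = (\<integral>\<^sup>+Y. \<integral>\<^sup>+Y'. ?c * (?g1 (fst Y) * ?g2 (snd Y)) * ?U (Y' - Y) \<partial>lborel \<partial>lborel)"
      by (simp add: w mult_ac)
    \<comment> \<open>Only the uniform noise involves \<open>Y'\<close>, and it has mass 1 around
      every \<open>Y\<close>.\<close>
    also have "\<dots> = (\<integral>\<^sup>+Y. ?c * (?g1 (fst Y) * ?g2 (snd Y)) \<partial>lborel)"
      by (intro nn_integral_cong) (simp add: nn_integral_cmult U_shift[simplified])
    \<comment> \<open>For fixed hyperpriors the integrand is a product over the terminals, so the
      integral over both latents factorises.\<close>
    also have "\<dots> = ?c * (ennreal (channel_output_density \<epsilon> T1 z1 s1) * ennreal (channel_output_density \<epsilon> T2 z2 s2))"
      using nn_integral_lborel_pair_mult[of ?g1 ?g2]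
      by (simp add: nn_integral_cmult ennreal_channel_output_density[OF T(1) \<epsilon>]
          ennreal_channel_output_density[OF T(2) \<epsilon>])
    also have "\<dots> = ennreal (output_hyper_density \<epsilon> T1 T2 pz w) * indicator A w"
      using channel_output_density_pos[OF T(1) \<epsilon>, of z1 s1] channel_output_density_pos[OF T(2) \<epsilon>, of z2 s2]
      by (simp add: w output_hyper_density_def ennreal_mult' pz0 mult_ac)
    finally show "(\<integral>\<^sup>+Y. \<integral>\<^sup>+Y'. ?F Y Y' (fst w, fst (snd w)) (snd (snd w)) \<partial>lborel \<partial>lborel)
        = ennreal (output_hyper_density \<epsilon> T1 T2 pz w) * indicator A w"
      by (simp add: w)
  qed
  finally show "emeasure (output_hyper_law \<epsilon> T1 T2 pz) A
      = emeasure (density lborel (\<lambda>w. ennreal (output_hyper_density \<epsilon> T1 T2 pz w))) A"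
    by (simp add: emeasure_density)
qed

section \<open>The divergence\<close>

text \<open>Dividing by the positive marginal only shifts the log joint density by a constant. This
  constant and \<open>ln (q w)\<close> are integrable under \<open>q\<close>, so they split off even
  when the remaining expectation is infinite.\<close>

lemma KL_density_posterior:
  fixes q :: "'b::euclidean_space \<Rightarrow> real" and p :: "'a::euclidean_space \<times> 'b \<Rightarrow> real"
  assumes q[measurable]: "q \<in> borel_measurable borel" and q0: "\<And>w. 0 \<le> q w"
    and q1: "(\<integral>\<^sup>+w. ennreal (q w) \<partial>lborel) = 1"
    and ent: "integrable lborel (\<lambda>w. q w * ln (q w))"
    and p[measurable]: "p \<in> borel_measurable borel" and p0: "\<And>v. 0 \<le> p v"
    and r: "0 < (\<integral>w. p (x, w) \<partial>lborel)"
  shows "KL_density q (posterior p x) = ereal_expectation (density lborel q) (\<lambda>w. - elog (p (x, w)))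
    + ereal ((\<integral>w. q w * ln (q w) \<partial>lborel) + ln (\<integral>w. p (x, w) \<partial>lborel))"
proof -
  define r where "r = (\<integral>w. p (x, w) \<partial>lborel)"
  then have "0 < r" using r by simp
  interpret Q: prob_space "density lborel q"
    by (rule prob_spaceI) (simp add: emeasure_density q1)
  have int: "integrable (density lborel q) (\<lambda>w. ln (q w))"
    using ent q0 by (simp add: integrable_density)
  \<comment> \<open>Only points with \<open>q w > 0\<close> count. If the joint density vanishes at
    such a point, both sides are \<open>\<infinity>\<close>.\<close>
  have "AE w in density lborel q. elog (q w) - elog (posterior p x w)
      = - elog (p (x, w)) + ereal (ln (q w) + ln r)"
  proof (subst AE_density, simp, intro AE_I2 impI)
    fix w assume "0 < ennreal (q w)"
    then have "0 < q w" by (simp add: ennreal_less_zero_iff)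
    then show "elog (q w) - elog (posterior p x w) = - elog (p (x, w)) + ereal (ln (q w) + ln r)"
      using \<open>0 < r\<close> p0[of "(x, w)"]
      by (auto simp: elog_def posterior_def r_def[symmetric] ln_div divide_le_0_iff)
  qed
  then have "KL_density q (posterior p x)
      = ereal_expectation (density lborel q) (\<lambda>w. - elog (p (x, w)) + ereal (ln (q w) + ln r))"
    unfolding KL_density_def by (rule ereal_expectation_cong_AE)
  also have "\<dots> = ereal_expectation (density lborel q) (\<lambda>w. - elog (p (x, w)))
      + ereal (\<integral>w. ln (q w) + ln r \<partial>density lborel q)"
    using int by (intro ereal_expectation_add_integrable) auto
  also have "(\<integral>w. ln (q w) + ln r \<partial>density lborel q) = (\<integral>w. q w * ln (q w) \<partial>lborel) + ln r"
    using int q0 Q.prob_space by (simp add: integral_density)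
  finally show ?thesis
    by (simp add: r_def)
qed

text \<open>Lebesgue measure is sigma-finite, so densities are unique up to null sets. The Bochner
  form is recorded too, because \<open>posterior\<close> and \<open>likelihood\<close> normalise
  with it.\<close>

lemma AE_marginal_density:
  fixes p :: "'a::euclidean_space \<times> 'b::euclidean_space \<Rightarrow> real"
  assumes [measurable]: "p \<in> borel_measurable borel" "f \<in> borel_measurable borel"
    and p0: "\<And>v. 0 \<le> p v" and f0: "\<And>x. 0 \<le> f x"
    and eq: "density lborel (\<lambda>x. \<integral>\<^sup>+w. ennreal (p (x, w)) \<partial>lborel) = density lborel (\<lambda>x. ennreal (f x))"
  shows "AE x in lborel. (\<integral>\<^sup>+w. ennreal (p (x, w)) \<partial>lborel) = ennreal (f x) \<and> (\<integral>w. p (x, w) \<partial>lborel) = f x"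
proof -
  have "AE x in lborel. (\<integral>\<^sup>+w. ennreal (p (x, w)) \<partial>lborel) = ennreal (f x)"
    by (rule sigma_finite_measure.density_unique[OF sigma_finite_lborel _ _ eq]) measurable
  then show ?thesis
    by eventually_elim (simp add: integral_eq_nn_integral p0 f0)
qed

text \<open>Bayes' rule in logarithms: \<open>t\<close> is the joint density at
  \<open>(x, w)\<close>, \<open>r\<close> the hyperprior density, \<open>c\<close> and
  \<open>d\<close> the channel densities. As \<open>c\<close> and \<open>d\<close> are positive,
  only infinities of one sign can occur.\<close>

lemma neg_elog_joint_eq:
  assumes "0 \<le> t" "0 \<le> r" "0 < c" "0 < d" "r * c * d = 0 \<longrightarrow> t = 0"
  shows "- elog (t / (r * c * d)) - elog c - elog d - elog r = - elog t"
\<comment> \<open>If \<open>r = 0\<close> then \<open>t = 0\<close>, and division by zero makes the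
  likelihood 0; both sides are \<open>\<infinity>\<close>.\<close>
proof (cases "r = 0")
  case True
  with assms show ?thesis by (simp add: elog_def)
next
  case False
  with assms have "0 < r" by simp
  with assms show ?thesis
    by (auto simp: elog_def ln_div ln_mult divide_le_0_iff mult_le_0_iff)
qed

theorem proposition1:
  fixes \<epsilon> :: real
    and px :: "('c::finite, 'h::finite, 'w::finite) image \<times> ('c, 'h, 'w) image \<Rightarrow> real"
  assumes "0 < \<epsilon>"
    and "px \<in> borel_measurable borel" and "\<And>x. 0 \<le> px x" and "prob_space (density lborel px)"
    and "integrable lborel (\<lambda>x. px x * ln (px x))"
  shows "\<exists>const :: real.
    \<forall>(T1 :: ('c, 'h, 'w, 'ny::finite, 'nz::finite, 'n::finite) terminal)
     (T2 :: ('c, 'h, 'w, 'ny, 'nz, 'n) terminal) pz p.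
      valid_terminal T1 \<and> valid_terminal T2 \<and> valid_hyper_density pz \<and>
      joint_model \<epsilon> T1 T2 pz px p \<longrightarrow>
        ereal_expectation (density lborel px)
          (\<lambda>x. KL_density (variational_density \<epsilon> T1 T2 x) (posterior p x))
        = ereal_expectation (density lborel px)
            (\<lambda>x. ereal_expectation (density lborel (variational_density \<epsilon> T1 T2 x))
              (\<lambda>(s1, s2, z1, z2).
                - elog (likelihood p x (s1, s2, z1, z2))
                - elog (channel_output_density \<epsilon> T1 z1 s1)
                - elog (channel_output_density \<epsilon> T2 z2 s2)
                - elog (pz (z1, z2))))
          + ereal const"
proof -
  note \<epsilon> = assms(1) and px0 = assms(3)
  note [measurable] = assms(2)
  define \<rho> :: "(complex ^ 'n) \<times> (complex ^ 'n) \<times> (real ^ 'nz) \<times> (real ^ 'nz) \<Rightarrow> real"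
    where "\<rho> = joint_noise_density \<epsilon>"
  have [measurable]: "\<rho> \<in> borel_measurable borel" and \<rho>0: "0 \<le> \<rho> w" for w
    by (simp_all add: \<rho>_def)
  \<comment> \<open>The negative differential entropy of the noise, in nats.\<close>
  define H where "H = (\<integral>w. \<rho> w * ln (\<rho> w) \<partial>lborel)"
  interpret P: prob_space "density lborel px" by fact
  have int_h: "integrable (density lborel px) (\<lambda>x. H + ln (px x))"
    using assms(5) px0 by (simp add: integrable_density)
  show ?thesis
  \<comment> \<open>The constant is minus the entropy of the noise minus that of the data. Its only
    parameters are \<open>\<epsilon>\<close> and \<open>px\<close>, so it is fixed before the
    terminals, \<open>pz\<close> and \<open>p\<close>.\<close>
  proof (intro exI[of _ "\<integral>x. H + ln (px x) \<partial>density lborel px"] allI impI, elim conjE)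
    fix T1 T2 :: "('c, 'h, 'w, 'ny, 'nz, 'n) terminal" and pz p
    assume T: "valid_terminal T1" "valid_terminal T2" and pz: "valid_hyper_density pz"
      and joint: "joint_model \<epsilon> T1 T2 pz px p"
    let ?M = "output_hyper_density \<epsilon> T1 T2 pz"
    let ?q = "variational_density \<epsilon> T1 T2"
    let ?c = "terminal_outputs T1 T2"
    have q: "?q x = (\<lambda>w. \<rho> (w - ?c x))" for x
      by (simp add: fun_eq_iff variational_density_eq \<rho>_def)
    note [measurable] = measurable_output_hyper_density[OF T pz \<epsilon>] measurable_terminal_outputs[OF T]
    have p[measurable]: "p \<in> borel_measurable borel" and p0: "0 \<le> p v" for v
      using joint unfolding joint_model_def by blast+
    have pz0: "0 \<le> pz z" for z
      using pz unfolding valid_hyper_density_def by blast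
    note c_pos = channel_output_density_pos[OF T(1) \<epsilon>] channel_output_density_pos[OF T(2) \<epsilon>]
    have M0: "0 \<le> ?M w" for w
      by (simp add: output_hyper_density_def split_beta pz0 less_imp_le[OF c_pos(1)] less_imp_le[OF c_pos(2)])
    have q_meas: "?q x \<in> borel_measurable borel" and q_nonneg: "0 \<le> ?q x w"
      and q_one: "(\<integral>\<^sup>+w. ennreal (?q x w) \<partial>lborel) = 1"
      and q_ent: "integrable lborel (\<lambda>w. ?q x w * ln (?q x w))"
      and q_H: "(\<integral>w. ?q x w * ln (?q x w) \<partial>lborel) = H" for x w
    proof -
      show "?q x \<in> borel_measurable borel" "0 \<le> ?q x w"
        by (simp_all add: q \<rho>0)
      show "(\<integral>\<^sup>+w. ennreal (?q x w) \<partial>lborel) = 1"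
        using nn_integral_lborel_translate[of "\<lambda>w. ennreal (\<rho> w)" "?c x"]
        by (simp add: q \<rho>_def nn_integral_joint_noise_density \<epsilon>)
      show "integrable lborel (\<lambda>w. ?q x w * ln (?q x w))"
        unfolding q
        by (rule integrable_lborel_translate[OF integrable_joint_noise_entropy[OF \<epsilon> \<rho>_def]])
      show "(\<integral>w. ?q x w * ln (?q x w) \<partial>lborel) = H"
        unfolding q H_def by (rule integral_lborel_translate) measurable
    qed

    define F where "F x = ereal_expectation (density lborel (?q x)) (\<lambda>w. - elog (p (x, w)))" for x
    \<comment> \<open>Writing the integrals over \<open>lborel\<close> moves the dependence on
      \<open>x\<close> from the measure into the integrand.\<close>
    have F_meas: "F \<in> borel_measurable borel"
      unfolding F_def ereal_expectation_def q
      by (simp add: nn_integral_density)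
    have marg_x: "AE x in lborel. (\<integral>\<^sup>+w. ennreal (p (x, w)) \<partial>lborel) = ennreal (px x) \<and>
        (\<integral>w. p (x, w) \<partial>lborel) = px x"
      using joint by (intro AE_marginal_density) (auto simp: joint_model_def px0)
    have marg_w: "AE w in lborel. (\<integral>\<^sup>+x. ennreal (p (x, w)) \<partial>lborel) = ennreal (?M w) \<and>
        (\<integral>x. p (x, w) \<partial>lborel) = ?M w"
    proof -
      have "0 \<le> (case v of (w, x) \<Rightarrow> p (x, w))" for v
        by (cases v) (simp add: p0)
      then show ?thesis
        using joint AE_marginal_density[of "\<lambda>(w, x). p (x, w)" ?M]
        by (simp add: joint_model_def output_hyper_law_eq_density[OF T pz \<epsilon>] M0)
    qed

    \<comment> \<open>Under the data law \<open>px x > 0\<close> almost surely, so the posterior is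
      a genuine quotient; points with \<open>px x = 0\<close> carry no mass.\<close>
    have "AE x in density lborel px. KL_density (?q x) (posterior p x) = F x + ereal (H + ln (px x))"
    proof (subst AE_density, simp, use marg_x in eventually_elim, intro impI)
      fix x assume *: "(\<integral>\<^sup>+w. ennreal (p (x, w)) \<partial>lborel) = ennreal (px x) \<and> (\<integral>w. p (x, w) \<partial>lborel) = px x"
        and "0 < ennreal (px x)"
      then have "0 < (\<integral>w. p (x, w) \<partial>lborel)"
        by (simp add: ennreal_less_zero_iff)
      from KL_density_posterior[OF q_meas q_nonneg q_one q_ent p p0 this] *
      show "KL_density (?q x) (posterior p x) = F x + ereal (H + ln (px x))"
        by (simp add: F_def q_H)
    qed
    then have "ereal_expectation (density lborel px) (\<lambda>x. KL_density (?q x) (posterior p x))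
        = ereal_expectation (density lborel px) (\<lambda>x. F x + ereal (H + ln (px x)))"
      by (rule ereal_expectation_cong_AE)
    also have "\<dots> = ereal_expectation (density lborel px) F + ereal (\<integral>x. H + ln (px x) \<partial>density lborel px)"
      using F_meas int_h by (intro ereal_expectation_add_integrable) auto
    also have "ereal_expectation (density lborel px) F = ereal_expectation (density lborel px)
            (\<lambda>x. ereal_expectation (density lborel (?q x))
              (\<lambda>(s1, s2, z1, z2).
                - elog (likelihood p x (s1, s2, z1, z2))
                - elog (channel_output_density \<epsilon> T1 z1 s1)
                - elog (channel_output_density \<epsilon> T2 z2 s2)
                - elog (pz (z1, z2))))"
    proof (rule ereal_expectation_cong_AE)
      \<comment> \<open>A zero marginal at \<open>w\<close> forces the nonnegative joint density to
        vanish for almost all \<open>x\<close>. This is the last premise of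
        \<open>neg_elog_joint_eq\<close>.\<close>
      have "AE w in lborel. AE x in lborel. ?M w = 0 \<longrightarrow> p (x, w) = 0"
        using marg_w
      proof eventually_elim
        fix w assume "(\<integral>\<^sup>+x. ennreal (p (x, w)) \<partial>lborel) = ennreal (?M w) \<and> (\<integral>x. p (x, w) \<partial>lborel) = ?M w"
        then show "AE x in lborel. ?M w = 0 \<longrightarrow> p (x, w) = 0"
          by (cases "?M w = 0") (auto simp: nn_integral_0_iff_AE p0 ennreal_eq_0_iff order.antisym elim!: eventually_mono)
      qed
      moreover have "Measurable.pred (lborel \<Otimes>\<^sub>M lborel) (\<lambda>v. ?M (snd v) = 0 \<longrightarrow> p (fst v, snd v) = 0)"
        by measurable
      \<comment> \<open>The inner expectation fixes \<open>x\<close> first, so the two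
        almost-everywhere quantifiers are exchanged by Fubini.\<close>
      ultimately have "AE x in lborel. AE w in lborel. ?M w = 0 \<longrightarrow> p (x, w) = 0"
        by (subst lborel_pair.AE_commute) (simp_all only: pred_def)
      then have "AE x in lborel. F x = ereal_expectation (density lborel (?q x))
              (\<lambda>(s1, s2, z1, z2).
                - elog (likelihood p x (s1, s2, z1, z2))
                - elog (channel_output_density \<epsilon> T1 z1 s1)
                - elog (channel_output_density \<epsilon> T2 z2 s2)
                - elog (pz (z1, z2)))"
      proof eventually_elim
        case (elim x)
        \<comment> \<open>By \<open>marg_w\<close> the denominator of the likelihood is
          \<open>?M w\<close>, whose factors are those of the rate terms; only the joint density
          survives.\<close>
        have "AE w in lborel. (\<lambda>(s1, s2, z1, z2).
                - elog (likelihood p x (s1, s2, z1, z2))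
                - elog (channel_output_density \<epsilon> T1 z1 s1)
                - elog (channel_output_density \<epsilon> T2 z2 s2)
                - elog (pz (z1, z2))) w = - elog (p (x, w))"
          using elim marg_w
        proof eventually_elim
          case (elim w)
          obtain s1 s2 z1 z2 where w: "w = (s1, s2, z1, z2)" by (metis surj_pair)
          have "?M w = pz (z1, z2) * channel_output_density \<epsilon> T1 z1 s1 * channel_output_density \<epsilon> T2 z2 s2"
            by (simp add: w output_hyper_density_def)
          with elim show ?case
            using neg_elog_joint_eq[OF p0[of "(x, w)"] pz0[of "(z1, z2)"] c_pos(1)[of z1 s1] c_pos(2)[of z2 s2]]
            by (simp add: w likelihood_def)
        qed
        then show ?case
          unfolding F_def using q_meas[of x]
          by (intro ereal_expectation_cong_AE) (auto simp: AE_density elim!: eventually_mono)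
      qed
      then show "AE x in density lborel px. F x = ereal_expectation (density lborel (?q x))
              (\<lambda>(s1, s2, z1, z2).
                - elog (likelihood p x (s1, s2, z1, z2))
                - elog (channel_output_density \<epsilon> T1 z1 s1)
                - elog (channel_output_density \<epsilon> T2 z2 s2)
                - elog (pz (z1, z2)))"
        by (auto simp: AE_density elim!: eventually_mono)
    qed
    finally show "ereal_expectation (density lborel px)
          (\<lambda>x. KL_density (?q x) (posterior p x))
        = ereal_expectation (density lborel px)
            (\<lambda>x. ereal_expectation (density lborel (?q x))
              (\<lambda>(s1, s2, z1, z2).
                - elog (likelihood p x (s1, s2, z1, z2))
                - elog (channel_output_density \<epsilon> T1 z1 s1)
                - elog (channel_output_density \<epsilon> T2 z2 s2)
                - elog (pz (z1, z2))))
          + ereal (\<integral>x. H + ln (px x) \<partial>density lborel px)" .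
  qed
qed

end
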